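(* Let $\delta>0$ be a constant (with $2-\delta\ge 1$). Given any time instant $t_0$, there exist (for arbitrarily large $n$) an $n$-vertex tree $T$, an adversarial evolver $\mathcal{E}$, and a time instant $t>t_0$ such that $D(\mathcal{T},\mathcal{H})_{(t)}\in\Omega(n^2)$ for any algorithm in the class $\mathcal{C}$ running with speedup factor $2-\delta$.
   Context: Setting: $T=(V,E)$ is a fixed tree with $n$ vertices; labels $L=\{l_1,\dots,l_n\}$ are placed by a bijection $M_T:L\to V$ (the true labeling $\mathcal{T}$). Each evolver step selects an edge of $T$ and swaps the labels at its endpoints; an adversarial evolver may choose the edges arbitrarily. An algorithm maintains $\mathcal{H}=(T,M_H)$ with $M_H:L\to V$ an arbitrary map. An oracle $\mathcal{O}(l,u)$ returns null if $M_T(l)=u$ and otherwise the edge incident to $u$ on the tree path from $u$ to $M_T(l)$. The class $\mathcal{C}$ consists of algorithms each of whose steps selects a label $l$ and a vertex $u$, queries $\mathcal{O}(l,u)$, and may then move $l$ from $M_H(l)$ to an adjacent vertex of $T$. With speedup $c$, the algorithm performs one step per time unit and the evolver one swap every $c$ time units. The distance is $D(\mathcal{T},\mathcal{H})=\sum_{l\in L} d_T(M_T(l),M_H(l))$, $d_T$ the tree path length, and $D(\mathcal{T},\mathcal{H})_{(t)}$ is its value at time $t$. The $\Omega(n^2)$ bound means $D(\mathcal{T},\mathcal{H})_{(t)}\ge \gamma n^2$ for a constant $\gamma>0$ depending only on $\delta$. *)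

theory Defs
  imports Complex_Main "HOL-Combinatorics.Transposition" "Graph_Theory.Digraph_Component"
begin

section \<open>Trees\<close>

text \<open>
  A simple undirected graph is a \<^locale>\<open>pair_graph\<close>: finite, loop-free, and containing with every
  arc its reversal. In this representation \<^const>\<open>pre_digraph.cycle\<close> also counts
  \<open>u \<rightarrow> v \<rightarrow> u\<close>, so \<^const>\<open>tree\<close> is not the notion of an undirected tree; the cycles of the
  undirected graph are those of length at least 3.
\<close>

definition undirected_tree :: "'v pair_pre_digraph \<Rightarrow> bool" where
  "undirected_tree T \<longleftrightarrow> pair_graph T \<and> connected (with_proj T) \<and>
     \<not> (\<exists>p. pre_digraph.cycle (with_proj T) p \<and> length p \<ge> 3)"

definition tree_path :: "'v pair_pre_digraph \<Rightarrow> 'v \<Rightarrow> 'v \<Rightarrow> ('v \<times> 'v) list" where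
  "tree_path T u v = (THE p. pre_digraph.apath (with_proj T) u p v)"

definition tree_dist :: "'v pair_pre_digraph \<Rightarrow> 'v \<Rightarrow> 'v \<Rightarrow> nat" where
  "tree_dist T u v = length (tree_path T u v)"


section \<open>Labelings, evolver and oracle\<close>

text \<open>Only the values of a labeling on the label set are meaningful.\<close>

type_synonym ('l, 'v) labeling = "'l \<Rightarrow> 'v"

definition distance :: "'v pair_pre_digraph \<Rightarrow> 'l set \<Rightarrow> ('l, 'v) labeling \<Rightarrow> ('l, 'v) labeling \<Rightarrow> nat" where
  "distance T L M H = (\<Sum>l\<in>L. tree_dist T (M l) (H l))"

definition swap_labels :: "'v \<times> 'v \<Rightarrow> ('l, 'v) labeling \<Rightarrow> ('l, 'v) labeling" where
  "swap_labels e M = transpose (fst e) (snd e) \<circ> M"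

text \<open>The edge returned by the oracle is given as the arc leaving \<open>u\<close>.\<close>

definition oracle_answer ::
    "'v pair_pre_digraph \<Rightarrow> ('l, 'v) labeling \<Rightarrow> 'l \<Rightarrow> 'v \<Rightarrow> ('v \<times> 'v) option" where
  "oracle_answer T M l u = (if M l = u then None else Some (hd (tree_path T u (M l))))"

text \<open>
  A configuration is the pair \<open>(M\<^sub>T, M\<^sub>H)\<close>. The evolver is adaptive: it picks the edge to swap
  from all configurations so far, the most recent one first.
\<close>

type_synonym ('l, 'v) config = "('l, 'v) labeling \<times> ('l, 'v) labeling"

type_synonym ('l, 'v) evolver = "('l, 'v) config list \<Rightarrow> 'v \<times> 'v"

definition is_evolver :: "'v pair_pre_digraph \<Rightarrow> ('l, 'v) evolver \<Rightarrow> bool" where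
  "is_evolver T E \<longleftrightarrow> (\<forall>h. E h \<in> parcs T)"


section \<open>The class of algorithms\<close>

text \<open>
  The true labeling is accessible to an algorithm only through the queries made so far,
  recorded with their answers, the most recent one first. From this record the algorithm chooses the
  next query; once the answer has been added to the record, it decides whether to move the queried
  label and to which vertex.
\<close>

type_synonym ('l, 'v) record_of_queries = "('l \<times> 'v \<times> ('v \<times> 'v) option) list"

record ('l, 'v) algorithm =
  init_hyp :: "('l, 'v) labeling"
  next_query :: "('l, 'v) record_of_queries \<Rightarrow> 'l \<times> 'v"
  next_move :: "('l, 'v) record_of_queries \<Rightarrow> 'v option"

primrec hypothesis :: "('l, 'v) algorithm \<Rightarrow> ('l, 'v) record_of_queries \<Rightarrow> ('l, 'v) labeling" where
  "hypothesis A [] = init_hyp A"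
| "hypothesis A (q # qs) =
     (case next_move A (q # qs) of
        None \<Rightarrow> hypothesis A qs
      | Some w \<Rightarrow> (hypothesis A qs)(fst q := w))"

definition class_C :: "'v pair_pre_digraph \<Rightarrow> 'l set \<Rightarrow> ('l, 'v) algorithm set" where
  "class_C T L = {A.
     (\<forall>l\<in>L. init_hyp A l \<in> pverts T) \<and>
     (\<forall>qs. next_query A qs \<in> L \<times> pverts T) \<and>
     (\<forall>q qs w. next_move A (q # qs) = Some w \<longrightarrow> (hypothesis A qs (fst q), w) \<in> parcs T)}"


section \<open>The process\<close>

text \<open>
  With speedup \<open>c\<close> the algorithm makes its steps at the times \<open>1, 2, 3, \<dots>\<close> and the evolver its swaps
  at the times \<open>c, 2 * c, 3 * c, \<dots>\<close>; a swap falling on an integer time precedes the step at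
  that time. For \<open>c \<ge> 1\<close> at most one swap falls into the interval from \<open>t\<close> (excluded) to \<open>t + 1\<close>
  (included), and \<open>swap_due c t\<close> says that there is one.
\<close>

definition swap_due :: "real \<Rightarrow> nat \<Rightarrow> bool" where
  "swap_due c t \<longleftrightarrow> (\<exists>j::nat. j \<ge> 1 \<and> real t < real j * c \<and> real j * c \<le> real (t + 1))"

primrec run ::
    "'v pair_pre_digraph \<Rightarrow> real \<Rightarrow> ('l, 'v) evolver \<Rightarrow> ('l, 'v) labeling \<Rightarrow> ('l, 'v) algorithm \<Rightarrow>
     nat \<Rightarrow> ('l, 'v) config list \<times> ('l, 'v) record_of_queries" where
  "run T c E M\<^sub>0 A 0 = ([(M\<^sub>0, init_hyp A)], [])"
| "run T c E M\<^sub>0 A (Suc t) =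
     (let (h, qs) = run T c E M\<^sub>0 A t;
          M = fst (hd h);
          M' = (if swap_due c t then swap_labels (E h) M else M);
          (l, u) = next_query A qs;
          qs' = (l, u, oracle_answer T M' l u) # qs
      in ((M', hypothesis A qs') # h, qs'))"

definition distance_at ::
    "'v pair_pre_digraph \<Rightarrow> 'l set \<Rightarrow> real \<Rightarrow> ('l, 'v) evolver \<Rightarrow> ('l, 'v) labeling \<Rightarrow>
     ('l, 'v) algorithm \<Rightarrow> nat \<Rightarrow> nat" where
  "distance_at T L c E M\<^sub>0 A t = (let (M, H) = hd (fst (run T c E M\<^sub>0 A t)) in distance T L M H)"

end

theory Submission
  imports Defs
begin

text \<open>
  The tree is a path on \<open>4 * h\<close> vertices. At time \<open>t\<^sub>0\<close> the evolver looks at the two halves of the path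
  and selects the one whose labels contribute less to the distance \<open>D\<close>, say \<open>B \<le> D - B\<close>. With its next
  \<open>h\<^sup>2\<close> swaps it exchanges the two quarters of this half. Every swap moves one label right and one left,
  and no label ever turns back, so the \<open>2 * h\<close> labels of the half end up displaced by \<open>h\<close> each, which is
  the most that \<open>h\<^sup>2\<close> swaps can achieve. By the triangle inequality the distance to the hypothesis of
  time \<open>t\<^sub>0\<close> is then at least \<open>(2 * h\<^sup>2 - B) + (D - B) \<ge> 2 * h\<^sup>2\<close>, whatever \<open>D\<close> was. Meanwhile the
  algorithm makes at most \<open>(2 - \<delta>) * h\<^sup>2 + 1\<close> moves, each worth at most 1, so a distance of at least
  \<open>\<delta> * h\<^sup>2 - 1\<close> remains.
\<close>

section \<open>Paths as trees\<close>

definition path_graph :: "nat \<Rightarrow> nat pair_pre_digraph" where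
  "path_graph n =
     \<lparr> pverts = {..<n}, parcs = {(u, v). u < n \<and> v < n \<and> (v = Suc u \<or> u = Suc v)} \<rparr>"

lemma pverts_path_graph [simp]: "pverts (path_graph n) = {..<n}"
  by (simp add: path_graph_def)

lemma arc_path_graph_iff [simp]:
  "(u, v) \<in> parcs (path_graph n) \<longleftrightarrow> u < n \<and> v < n \<and> (v = Suc u \<or> u = Suc v)"
  by (simp add: path_graph_def)

lemma pair_graph_path_graph: "pair_graph (path_graph n)"
proof -
  have "parcs (path_graph n) \<subseteq> {..<n} \<times> {..<n}"
    by auto
  then have "finite (parcs (path_graph n))"
    by (rule finite_subset) simp
  then show ?thesis
    by unfold_locales (auto simp: symmetric_def sym_def)
qed

lemma reachable_path_graph:
  assumes "u < n" and "v < n"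
  shows "reachable (with_proj (path_graph n)) u v"
proof -
  interpret pair_graph "path_graph n"
    by (rule pair_graph_path_graph)
  have zero: "reachable (with_proj (path_graph n)) 0 w" if "w < n" for w
    using that
  proof (induction w)
    case 0
    then show ?case by simp
  next
    case (Suc w)
    then have "reachable (with_proj (path_graph n)) 0 w" and "(w, Suc w) \<in> parcs (path_graph n)"
      by simp_all
    then show ?case
      by (rule reachable_adj_trans)
  qed
  have "reachable (with_proj (path_graph n)) u 0"
    using symmetric_reachable[OF sym_arcs zero[OF assms(1)]] .
  then show ?thesis
    using zero[OF assms(2)] by (rule reachable_trans)
qed

lemma connected_path_graph:
  assumes "0 < n"
  shows "connected (with_proj (path_graph n))"
proof -
  interpret pair_graph "path_graph n"
    by (rule pair_graph_path_graph)
  show ?thesis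
    unfolding connected_def
  proof (rule strongly_connectedI)
    show "verts (with_proj (mk_symmetric (with_proj (path_graph n)))) \<noteq> {}"
      using assms by auto
  qed (auto intro: reachable_mk_symmetricI reachable_path_graph)
qed

text \<open>Each arc changes the vertex by one, so a walk cannot get from one side of
  \<open>u\<close> to the other without visiting \<open>u\<close>.\<close>

lemma awalk_path_graph_same_side:
  assumes "pre_digraph.awalk (with_proj (path_graph n)) w p v" and "u \<notin> set (pawalk_verts w p)"
  shows "u < w \<longleftrightarrow> u < v"
proof -
  interpret pair_graph "path_graph n"
    by (rule pair_graph_path_graph)
  show ?thesis
    using assms
  proof (induction p arbitrary: w)
    case Nil
    then show ?case
      by (simp add: awalk_Nil_iff)
  next
    case (Cons e p)
    then have arc: "e \<in> parcs (path_graph n)" "fst e = w" and walk: "awalk (snd e) p v"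
      by (auto simp: awalk_Cons_iff)
    have "snd e \<in> set (pawalk_verts (snd e) p)"
      using hd_in_awalk_verts(1)[OF walk] by simp
    then have "u \<noteq> w" "u \<noteq> snd e"
      using Cons.prems arc by auto
    moreover have "u < snd e \<longleftrightarrow> u < v"
      using Cons walk by simp
    moreover have "snd e = Suc w \<or> w = Suc (snd e)"
      using arc by (cases e) auto
    ultimately show ?case
      by linarith
  qed
qed

definition segment :: "nat \<Rightarrow> nat \<Rightarrow> (nat \<times> nat) list" where
  "segment u v =
     (if u \<le> v then map (\<lambda>i. (i, Suc i)) [u..<v] else rev (map (\<lambda>i. (Suc i, i)) [v..<u]))"

text \<open>After its first arc the path may not return to \<open>u\<close>, so it stays on the side
  that this arc enters. Hence the arc points towards \<open>v\<close>, and induction fixes the rest.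
  This uniqueness evaluates the description operator in \<open>tree_path\<close>.\<close>

lemma apath_path_graph_eq_segment:
  assumes "pre_digraph.apath (with_proj (path_graph n)) u p v"
  shows "p = segment u v"
proof -
  interpret pair_graph "path_graph n"
    by (rule pair_graph_path_graph)
  show ?thesis
    using assms
  proof (induction p arbitrary: u)
    case Nil
    then show ?case
      by (simp add: apath_Nil_iff segment_def)
  next
    case (Cons e p)
    then have arc: "e \<in> parcs (path_graph n)" "fst e = u" and path: "apath (snd e) p v"
      and avoid: "u \<notin> set (pawalk_verts (snd e) p)"
      by (auto simp: apath_Cons_iff)
    have walk: "awalk (snd e) p v"
      using path by (rule awalkI_apath)
    have "v \<in> set (pawalk_verts (snd e) p)"
      using walk by (metis awalk_verts_non_Nil awlast_if_cas last_in_set awalkE)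
    then have "v \<noteq> u"
      using avoid by auto
    have side: "u < snd e \<longleftrightarrow> u < v"
      by (rule awalk_path_graph_same_side[OF walk avoid])
    have p: "p = segment (snd e) v"
      by (rule Cons.IH[OF path])
    from arc consider "e = (u, Suc u)" | w where "u = Suc w" "e = (Suc w, w)"
      by (cases e) auto
    then show ?case
    proof cases
      case 1
      then have "u < v" using side by simp
      then show ?thesis
        using 1 p by (simp add: segment_def upt_conv_Cons)
    next
      case 2
      then have "v \<le> w" using side \<open>v \<noteq> u\<close> by simp
      then show ?thesis
        using 2 p by (auto simp: segment_def)
    qed
  qed
qed

lemma undirected_tree_path_graph:
  assumes "0 < n"
  shows "undirected_tree (path_graph n)"
proof -
  interpret pair_graph "path_graph n"
    by (rule pair_graph_path_graph)
  have "length p < 3" if "cycle p" for p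
  proof -
    from that obtain u e q where p: "p = e # q" and walk: "awalk u (e # q) u"
      and dist: "distinct (pawalk_verts (snd e) q)"
      unfolding cycle_def by (metis list.exhaust list.sel(3) pawalk_verts.simps(2))
    \<comment> \<open>Without its first arc a cycle is a simple path back between adjacent vertices.
      By uniqueness it is the single reversed arc, so the cycle has length 2.\<close>
    from walk dist have "apath (snd e) q u" and arc: "e \<in> parcs (path_graph n)" "fst e = u"
      by (auto simp: awalk_Cons_iff apath_def)
    then have "q = segment (snd e) u"
      by (simp add: apath_path_graph_eq_segment)
    then show ?thesis
      using arc p by (cases e) (auto simp: segment_def)
  qed
  then show ?thesis
    unfolding undirected_tree_def
    using pair_graph_path_graph connected_path_graph[OF assms] by (auto simp: not_le)
qed

lemma tree_dist_path_graph:
  assumes "u < n" and "v < n"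
  shows "int (tree_dist (path_graph n) u v) = \<bar>int u - int v\<bar>"
proof -
  interpret pair_graph "path_graph n"
    by (rule pair_graph_path_graph)
  obtain p where "apath u p v"
    using reachable_path_graph[OF assms] by (auto simp: reachable_apath)
  then have "tree_path (path_graph n) u v = segment u v"
    unfolding tree_path_def
    by (metis (mono_tags, lifting) apath_path_graph_eq_segment the_equality)
  then show ?thesis
    by (simp add: tree_dist_def segment_def)
qed

section \<open>Exchanging two adjacent blocks\<close>

text \<open>With \<open>j = q div h\<close> and \<open>i = q mod h\<close>, the label that started
  at \<open>a + h + j\<close> has made \<open>i\<close> moves and sits at the second endpoint; the
  swap takes it one vertex further left.\<close>

definition exchange_edge :: "nat \<Rightarrow> nat \<Rightarrow> nat \<Rightarrow> nat \<times> nat" where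
  "exchange_edge a h q =
     (a + h + q div h - Suc (q mod h), a + h + q div h - q mod h)"

text \<open>
  The position, after the first \<open>q\<close> swaps, of the label that started at \<open>p\<close>. The labels of the right
  block \<open>{a + h..<a + 2 * h}\<close> travel one after the other, each across the whole left block: \<open>j\<close> of them
  have arrived, and the next one has made \<open>i\<close> of its \<open>h\<close> moves.
\<close>

definition exchange :: "nat \<Rightarrow> nat \<Rightarrow> nat \<Rightarrow> nat \<Rightarrow> nat" where
  "exchange a h q p =
     (let j = q div h; i = q mod h in
      if p < a \<or> a + h + j < p then p
      else if p < a + h then (if p + i < a + h then p + j else Suc (p + j))
      else if p < a + h + j then p - h
      else p - i)"

lemma exchange_0 [simp]: "0 < h \<Longrightarrow> exchange a h 0 = id"
  by (auto simp: exchange_def fun_eq_iff)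

lemma exchange_Suc:
  assumes "q < h * h"
  shows "exchange a h (Suc q) =
    transpose (fst (exchange_edge a h q)) (snd (exchange_edge a h q)) \<circ> exchange a h q"
proof -
  have h: "0 < h" using assms by (cases h) auto
  define i j where "i = q mod h" and "j = q div h"
  have i: "i < h" using h by (simp add: i_def)
  have j: "j < h" using assms by (simp add: j_def less_mult_imp_div_less)
  show ?thesis
  proof (cases "Suc i = h")
    \<comment> \<open>The travelling label arrives: the counters roll over from
      \<open>(j, h - 1)\<close> to \<open>(j + 1, 0)\<close>, and every label of the left block has
      now been passed \<open>j + 1\<close> times.\<close>
    case True
    then have "Suc q div h = Suc j" "Suc q mod h = 0"
      by (auto simp: i_def j_def div_Suc mod_Suc)
    then show ?thesis
      using True i j
      by (auto simp: fun_eq_iff exchange_def exchange_edge_def transpose_def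
          simp flip: i_def j_def)
  next
    case False
    then have "Suc q div h = j" "Suc q mod h = Suc i"
      by (auto simp: i_def j_def div_Suc mod_Suc)
    then show ?thesis
      using False i j
      by (auto simp: fun_eq_iff exchange_def exchange_edge_def transpose_def
          simp flip: i_def j_def)
  qed
qed

text \<open>Here \<open>j = h\<close> and \<open>i = 0\<close>. A label at \<open>a + 2 * h\<close>
  falls into the last branch of \<open>exchange\<close>, which leaves it in place because
  \<open>i = 0\<close>.\<close>

lemma exchange_full:
  assumes "0 < h"
  shows "exchange a h (h * h) p =
    (if p < a \<or> a + 2 * h \<le> p then p else if p < a + h then p + h else p - h)"
  using assms by (auto simp: exchange_def Let_def)


section \<open>Distance gained by an exchange\<close>

abbreviation displacement :: "'l set \<Rightarrow> ('l \<Rightarrow> nat) \<Rightarrow> ('l \<Rightarrow> nat) \<Rightarrow> int" where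
  "displacement L f g \<equiv> (\<Sum>l\<in>L. \<bar>int (f l) - int (g l)\<bar>)"

lemma displacement_triangle:
  "displacement L f k \<le> displacement L f g + displacement L g k"
  by (auto simp flip: sum.distrib intro!: sum_mono)

lemma distance_path_graph:
  assumes "\<And>l. l \<in> L \<Longrightarrow> M l < n" and "\<And>l. l \<in> L \<Longrightarrow> H l < n"
  shows "int (distance (path_graph n) L M H) = displacement L M H"
  using assms by (simp add: distance_def tree_dist_path_graph)

definition labels_in_block :: "'l set \<Rightarrow> ('l \<Rightarrow> nat) \<Rightarrow> nat \<Rightarrow> nat \<Rightarrow> 'l set" where
  "labels_in_block L M a b = {l \<in> L. a \<le> M l \<and> M l < a + b}"

text \<open>The value is the left end of the half. Better means better for the evolver: labels that
  are close to their hypothesis gain the most from being moved.\<close>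

definition better_half :: "nat \<Rightarrow> 'l set \<Rightarrow> ('l \<Rightarrow> nat) \<Rightarrow> ('l \<Rightarrow> nat) \<Rightarrow> nat" where
  "better_half h L M H =
     (if displacement (labels_in_block L M 0 (2 * h)) M H
         \<le> displacement (labels_in_block L M (2 * h) (2 * h)) M H
      then 0 else 2 * h)"

lemma displacement_exchange:
  fixes M H :: "'l \<Rightarrow> nat"
  assumes "0 < h" and M: "bij_betw M L {..<4 * h}"
  defines "a \<equiv> better_half h L M H"
  shows "int (2 * h * h) \<le> displacement L (exchange a h (h * h) \<circ> M) H"
proof -
  define a' where "a' = 2 * h - a"
  define B B' where "B = labels_in_block L M a (2 * h)" and "B' = labels_in_block L M a' (2 * h)"
  have a: "a = 0 \<and> a' = 2 * h \<or> a = 2 * h \<and> a' = 0"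
    by (auto simp: a_def a'_def better_half_def)
  have Ml: "M l < 4 * h" if "l \<in> L" for l
    using M that by (auto simp: bij_betw_def)
  have L: "L = B \<union> B'" and disj: "B \<inter> B' = {}"
    using a Ml by (fastforce simp: B_def B'_def labels_in_block_def)+
  have fin: "finite B" "finite B'"
    using bij_betw_finite[OF M] L by auto
  have img: "M ` B = {a..<a + 2 * h}"
  proof
    show "{a..<a + 2 * h} \<subseteq> M ` B"
    proof
      fix p assume p: "p \<in> {a..<a + 2 * h}"
      then have "p \<in> M ` L"
        using a M by (auto simp: bij_betw_def)
      then show "p \<in> M ` B"
        using p by (auto simp: B_def labels_in_block_def)
    qed
  qed (auto simp: B_def labels_in_block_def)
  have "inj_on M B"
    using M L by (auto simp: bij_betw_def inj_on_Un)
  then have card: "card B = 2 * h"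
    using card_image[of M B] img by simp
  have le: "displacement B M H \<le> displacement B' M H"
    using a by (auto simp: B_def B'_def a_def better_half_def split: if_splits)
  have "int (2 * h * h) - displacement B M H = (\<Sum>l\<in>B. int h - \<bar>int (M l) - int (H l)\<bar>)"
    using card by (simp add: sum_subtractf)
  \<comment> \<open>Each label of \<open>B\<close> is displaced by exactly \<open>h\<close>, so the
    reverse triangle inequality applies to it.\<close>
  also have "\<dots> \<le> displacement B (exchange a h (h * h) \<circ> M) H"
  proof (rule sum_mono)
    fix l assume "l \<in> B"
    then show "int h - \<bar>int (M l) - int (H l)\<bar> \<le> \<bar>int ((exchange a h (h * h) \<circ> M) l) - int (H l)\<bar>"
      using exchange_full[OF \<open>0 < h\<close>, of a "M l"]
      by (auto simp: B_def labels_in_block_def)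
  qed
  finally have "int (2 * h * h) - displacement B M H
      \<le> displacement B (exchange a h (h * h) \<circ> M) H" .
  moreover have "displacement B' (exchange a h (h * h) \<circ> M) H = displacement B' M H"
  proof (rule sum.cong)
    fix l assume "l \<in> B'"
    then have "M l < a \<or> a + 2 * h \<le> M l"
      using a by (auto simp: B'_def labels_in_block_def)
    then show "\<bar>int ((exchange a h (h * h) \<circ> M) l) - int (H l)\<bar> = \<bar>int (M l) - int (H l)\<bar>"
      by (simp add: exchange_full[OF \<open>0 < h\<close>])
  qed simp
  moreover have "displacement L (exchange a h (h * h) \<circ> M) H =
      displacement B (exchange a h (h * h) \<circ> M) H + displacement B' (exchange a h (h * h) \<circ> M) H"
    unfolding L using fin disj by (rule sum.union_disjoint)
  ultimately show ?thesis
    using le by linarith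
qed

section \<open>Timing of the swaps\<close>

text \<open>For positive \<open>c\<close>, the number of swap times \<open>j * c\<close> with
  \<open>j \<ge> 1\<close> up to and including \<open>t\<close>.\<close>

definition swap_count :: "real \<Rightarrow> nat \<Rightarrow> nat" where
  "swap_count c t = nat \<lfloor>real t / c\<rfloor>"

lemma swap_count_eqI:
  assumes "0 < c" and "real m * c \<le> real t" and "real t < (real m + 1) * c"
  shows "swap_count c t = m"
proof -
  have "\<lfloor>real t / c\<rfloor> = int m"
    using assms by (intro floor_unique) (simp_all add: field_simps)
  then show ?thesis
    by (simp add: swap_count_def)
qed

lemma swap_count_bounds:
  assumes "0 < c"
  shows "real (swap_count c t) * c \<le> real t" and "real t < (real (swap_count c t) + 1) * c"
proof -
  have "0 \<le> real t / c"
    using assms by simp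
  then have "real (swap_count c t) \<le> real t / c" "real t / c < real (swap_count c t) + 1"
    unfolding swap_count_def by linarith+
  then show "real (swap_count c t) * c \<le> real t" "real t < (real (swap_count c t) + 1) * c"
    using assms by (simp_all add: field_simps)
qed

text \<open>Consecutive swap times are at least one apart, so a time unit contains at most one, and
  the only candidate is the successor of the current count.\<close>

lemma swap_count_Suc:
  assumes "1 \<le> c"
  shows "swap_count c (Suc t) = (if swap_due c t then Suc (swap_count c t) else swap_count c t)"
proof -
  note b = swap_count_bounds[of c t]
  have c: "0 < c" using assms by simp
  show ?thesis
  proof (cases "swap_due c t")
    case True
    then obtain j where j: "real t < real j * c" "real j * c \<le> real t + 1"
      by (auto simp: swap_due_def)
    have "real (swap_count c t) * c < real j * c"
      using b(1) c j by linarith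
    then have "Suc (swap_count c t) \<le> j"
      using c by simp
    then have "(real (swap_count c t) + 1) * c \<le> real j * c"
      using c by (intro mult_right_mono) auto
    then have "swap_count c (Suc t) = Suc (swap_count c t)"
      using b c j assms by (intro swap_count_eqI) (auto simp: algebra_simps)
    then show ?thesis using True by simp
  next
    case False
    then have "\<not> (real (Suc (swap_count c t)) * c \<le> real (t + 1))"
      using b c unfolding swap_due_def by (auto simp: algebra_simps dest!: spec[of _ "Suc (swap_count c t)"])
    then have "swap_count c (Suc t) = swap_count c t"
      using b c by (intro swap_count_eqI) (auto simp: algebra_simps)
    then show ?thesis using False by simp
  qed
qed

lemma swap_count_mono:
  assumes "1 \<le> c" and "s \<le> t"
  shows "swap_count c s \<le> swap_count c t"
  using assms(2) by (induction rule: dec_induct) (auto simp: swap_count_Suc[OF assms(1)])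

text \<open>The witness is the first integer time at or after the required swap. Rounding up costs
  less than 1, and because \<open>c \<ge> 1\<close> the next swap has not yet happened.\<close>

lemma ex_swap_count_eq:
  assumes c: "1 \<le> c" and "0 < k"
  obtains t where "t\<^sub>0 < t" and "swap_count c t = swap_count c t\<^sub>0 + k"
    and "real t \<le> real t\<^sub>0 + c * real k + 1"
proof -
  define m where "m = swap_count c t\<^sub>0 + k"
  define t where "t = nat \<lceil>real m * c\<rceil>"
  note b = swap_count_bounds[of c t\<^sub>0]
  have t: "real m * c \<le> real t" "real t < real m * c + 1"
    using c by (auto simp: t_def) linarith+
  have "(real (swap_count c t\<^sub>0) + 1) * c \<le> real m * c"
    using \<open>0 < k\<close> c by (intro mult_right_mono) (auto simp: m_def)
  then have "t\<^sub>0 < t"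
    using t b c by linarith
  moreover have "swap_count c t = m"
    using t c by (intro swap_count_eqI) (auto simp: algebra_simps)
  moreover have "real t \<le> real t\<^sub>0 + c * real k + 1"
    using t b c by (simp add: m_def algebra_simps)
  ultimately show ?thesis
    using that by (simp add: m_def)
qed

section \<open>Evolution of the labelings\<close>

definition true_at :: "'v pair_pre_digraph \<Rightarrow> real \<Rightarrow> ('l, 'v) evolver \<Rightarrow> ('l, 'v) labeling \<Rightarrow>
    ('l, 'v) algorithm \<Rightarrow> nat \<Rightarrow> ('l, 'v) labeling" where
  "true_at T c E M\<^sub>0 A t = fst (hd (fst (run T c E M\<^sub>0 A t)))"

text \<open>Read off the record of queries, which grows by one entry per time unit;
  \<open>hd_run\<close> shows that the configurations store the same labeling.\<close>

definition hyp_at :: "'v pair_pre_digraph \<Rightarrow> real \<Rightarrow> ('l, 'v) evolver \<Rightarrow> ('l, 'v) labeling \<Rightarrow>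
    ('l, 'v) algorithm \<Rightarrow> nat \<Rightarrow> ('l, 'v) labeling" where
  "hyp_at T c E M\<^sub>0 A t = hypothesis A (snd (run T c E M\<^sub>0 A t))"

lemma true_at_Suc:
  "true_at T c E M\<^sub>0 A (Suc t) =
    (if swap_due c t then swap_labels (E (fst (run T c E M\<^sub>0 A t))) (true_at T c E M\<^sub>0 A t)
     else true_at T c E M\<^sub>0 A t)"
  by (simp add: true_at_def Let_def case_prod_unfold)

lemma hd_run: "hd (fst (run T c E M\<^sub>0 A t)) = (true_at T c E M\<^sub>0 A t, hyp_at T c E M\<^sub>0 A t)"
  by (cases t) (simp_all add: true_at_def hyp_at_def Let_def case_prod_unfold)

lemma length_run: "length (fst (run T c E M\<^sub>0 A t)) = Suc t"
  by (induction t) (simp_all add: Let_def case_prod_unfold)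

text \<open>Histories are listed newest first. This lets the evolver recover the configuration of
  time \<open>t\<^sub>0\<close> later on.\<close>

lemma nth_run:
  assumes "s \<le> t"
  shows "fst (run T c E M\<^sub>0 A t) ! (t - s) = (true_at T c E M\<^sub>0 A s, hyp_at T c E M\<^sub>0 A s)"
  using assms
proof (induction rule: dec_induct)
  case base
  have "fst (run T c E M\<^sub>0 A s) \<noteq> []"
    using length_run[of T c E M\<^sub>0 A s] by auto
  then show ?case
    by (simp add: hd_run flip: hd_conv_nth)
next
  case (step t)
  then show ?case
    by (simp add: Let_def case_prod_unfold Suc_diff_le)
qed

lemma distance_at_eq:
  "distance_at T L c E M\<^sub>0 A t = distance T L (true_at T c E M\<^sub>0 A t) (hyp_at T c E M\<^sub>0 A t)"
  by (simp add: distance_at_def hd_run)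

lemma hypothesis_in_path_graph:
  assumes "A \<in> class_C (path_graph n) L" and "l \<in> L"
  shows "hypothesis A qs l < n"
proof (induction qs)
  case Nil
  then show ?case
    using assms by (auto simp: class_C_def)
next
  case (Cons q qs)
  have "(hypothesis A qs (fst q), w) \<in> parcs (path_graph n)" if "next_move A (q # qs) = Some w" for w
    using assms(1) that unfolding class_C_def by blast
  then show ?case
    using Cons by (auto split: option.split)
qed

text \<open>Only the queried label can move, and only along an arc.\<close>

lemma displacement_hypothesis_Cons:
  assumes "A \<in> class_C (path_graph n) L" and "finite L"
  shows "displacement L (hypothesis A (q # qs)) (hypothesis A qs) \<le> 1"
proof (cases "next_move A (q # qs)")
  case None
  then show ?thesis by simp
next
  case (Some w)
  then have "(hypothesis A qs (fst q), w) \<in> parcs (path_graph n)"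
    using assms(1) unfolding class_C_def by blast
  then have "\<bar>int w - int (hypothesis A qs (fst q))\<bar> \<le> 1"
    by auto
  moreover have "displacement L (hypothesis A (q # qs)) (hypothesis A qs) =
      (\<Sum>l\<in>L. if l = fst q then \<bar>int w - int (hypothesis A qs (fst q))\<bar> else 0)"
    using Some by (intro sum.cong) auto
  ultimately show ?thesis
    using assms(2) by simp
qed

lemma displacement_hyp_at:
  assumes "A \<in> class_C (path_graph n) L" and "finite L" and "s \<le> t"
  shows "displacement L (hyp_at (path_graph n) c E M\<^sub>0 A t) (hyp_at (path_graph n) c E M\<^sub>0 A s)
    \<le> int (t - s)"
  using assms(3)
proof (induction rule: dec_induct)
  case base
  then show ?case by simp
next
  case (step t)
  obtain q where "snd (run (path_graph n) c E M\<^sub>0 A (Suc t)) = q # snd (run (path_graph n) c E M\<^sub>0 A t)"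
    by (auto simp: Let_def case_prod_unfold)
  then have "displacement L (hyp_at (path_graph n) c E M\<^sub>0 A (Suc t)) (hyp_at (path_graph n) c E M\<^sub>0 A t)
      \<le> 1"
    using displacement_hypothesis_Cons[OF assms(1,2), of q] by (simp add: hyp_at_def del: run.simps)
  then show ?case
    using step displacement_triangle[of "hyp_at (path_graph n) c E M\<^sub>0 A (Suc t)"
        "hyp_at (path_graph n) c E M\<^sub>0 A s" L "hyp_at (path_graph n) c E M\<^sub>0 A t"]
    by (simp add: Suc_diff_le)
qed

lemma bij_betw_true_at:
  assumes "is_evolver (path_graph n) E" and "bij_betw M\<^sub>0 L {..<n}"
  shows "bij_betw (true_at (path_graph n) c E M\<^sub>0 A t) L {..<n}"
proof (induction t)
  case 0
  then show ?case
    using assms(2) by (simp add: true_at_def)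
next
  case (Suc t)
  obtain u v where e: "E (fst (run (path_graph n) c E M\<^sub>0 A t)) = (u, v)"
    by fastforce
  then have "(u, v) \<in> parcs (path_graph n)"
    using assms(1) by (metis is_evolver_def)
  then have "bij_betw (transpose u v) {..<n} {..<n}"
    by simp
  then show ?case
    using Suc e by (auto simp: true_at_Suc swap_labels_def intro: bij_betw_trans)
qed

section \<open>The adversary\<close>

text \<open>The evolver is fixed before \<open>M\<^sub>0\<close> and the algorithm, so it reads
  everything from the history, which has \<open>t + 1\<close> entries at time \<open>t\<close>. Up
  to \<open>t\<^sub>0\<close> the truncated subtractions give some arc, which is harmless since any
  bijection may stand at \<open>t\<^sub>0\<close>. The default \<open>(0, 1)\<close> keeps the
  choice an arc when the swap number runs far past the exchange.\<close>

definition exchange_evolver :: "nat \<Rightarrow> 'l set \<Rightarrow> real \<Rightarrow> nat \<Rightarrow> ('l, nat) evolver" where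
  "exchange_evolver h L c t\<^sub>0 cs =
     (let t = length cs - 1;
          (M, H) = cs ! (t - t\<^sub>0);
          e = exchange_edge (better_half h L M H) h (swap_count c t - swap_count c t\<^sub>0)
      in if e \<in> parcs (path_graph (4 * h)) then e else (0, 1))"

lemma is_evolver_exchange_evolver:
  assumes "0 < h"
  shows "is_evolver (path_graph (4 * h)) (exchange_evolver h L c t\<^sub>0)"
  using assms by (auto simp: is_evolver_def exchange_evolver_def Let_def case_prod_unfold)

lemma exchange_edge_arc:
  assumes "a \<le> 2 * h" and "q < h * h"
  shows "exchange_edge a h q \<in> parcs (path_graph (4 * h))"
proof -
  have "0 < h" using assms(2) by (cases h) auto
  then have "q mod h < h" "q div h < h"
    using assms(2) by (simp_all add: less_mult_imp_div_less)
  then show ?thesis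
    using assms(1) unfolding exchange_edge_def arc_path_graph_iff by linarith
qed

lemma true_at_exchange_evolver:
  fixes M\<^sub>0 :: "'l \<Rightarrow> nat" and L c t\<^sub>0 h A
  defines "X \<equiv> true_at (path_graph (4 * h)) c (exchange_evolver h L c t\<^sub>0) M\<^sub>0 A"
    and "Y \<equiv> hyp_at (path_graph (4 * h)) c (exchange_evolver h L c t\<^sub>0) M\<^sub>0 A"
  assumes "0 < h" and c: "1 \<le> c" and "t\<^sub>0 \<le> t"
    and "swap_count c t \<le> swap_count c t\<^sub>0 + h * h"
  shows "X t = exchange (better_half h L (X t\<^sub>0) (Y t\<^sub>0)) h (swap_count c t - swap_count c t\<^sub>0) \<circ> X t\<^sub>0"
  using \<open>t\<^sub>0 \<le> t\<close> assms(6)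
proof (induction rule: dec_induct)
  case base
  then show ?case
    using \<open>0 < h\<close> by simp
next
  case (step t)
  define a where "a = better_half h L (X t\<^sub>0) (Y t\<^sub>0)"
  define q where "q = swap_count c t - swap_count c t\<^sub>0"
  have mono: "swap_count c t\<^sub>0 \<le> swap_count c t"
    using c step by (intro swap_count_mono)
  show ?case
  proof (cases "swap_due c t")
    case True
    then have q: "q < h * h" "swap_count c (Suc t) - swap_count c t\<^sub>0 = Suc q"
      using step.prems mono by (auto simp: q_def swap_count_Suc[OF c])
    have "a \<le> 2 * h"
      by (simp add: a_def better_half_def)
    then have arc: "exchange_edge a h q \<in> parcs (path_graph (4 * h))"
      using q(1) by (rule exchange_edge_arc)
    \<comment> \<open>Entry \<open>t - t\<^sub>0\<close> of the history is always the configuration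
      of time \<open>t\<^sub>0\<close>, so every swap uses the same half; by \<open>arc\<close> the
      default is not taken.\<close>
    have "exchange_evolver h L c t\<^sub>0
        (fst (run (path_graph (4 * h)) c (exchange_evolver h L c t\<^sub>0) M\<^sub>0 A t)) = exchange_edge a h q"
      using arc unfolding exchange_evolver_def[of _ _ _ _ "fst _"]
      by (simp add: length_run nth_run[OF step.hyps(1)] Let_def a_def q_def X_def Y_def)
    then have "X (Suc t) = swap_labels (exchange_edge a h q) (X t)"
      using True unfolding X_def by (simp add: true_at_Suc)
    then show ?thesis
      using step True q
      by (simp add: swap_labels_def exchange_Suc o_assoc swap_count_Suc[OF c] flip: a_def q_def)
  next
    case False
    then show ?thesis
      using step by (simp add: X_def true_at_Suc swap_count_Suc[OF c])
  qed
qed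

lemma distance_at_exchange_evolver:
  assumes h: "0 < h" and c: "1 \<le> c" and "t\<^sub>0 \<le> t"
    and count: "swap_count c t = swap_count c t\<^sub>0 + h * h"
    and M0: "bij_betw M\<^sub>0 L {..<4 * h}" and A: "A \<in> class_C (path_graph (4 * h)) L"
  shows "int (2 * h * h) - int (t - t\<^sub>0)
    \<le> int (distance_at (path_graph (4 * h)) L c (exchange_evolver h L c t\<^sub>0) M\<^sub>0 A t)"
proof -
  define X where "X = true_at (path_graph (4 * h)) c (exchange_evolver h L c t\<^sub>0) M\<^sub>0 A"
  define Y where "Y = hyp_at (path_graph (4 * h)) c (exchange_evolver h L c t\<^sub>0) M\<^sub>0 A"
  have bij: "bij_betw (X s) L {..<4 * h}" for s
    unfolding X_def using is_evolver_exchange_evolver[OF h] M0 by (rule bij_betw_true_at)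
  have "int (2 * h * h) \<le> displacement L (X t) (Y t\<^sub>0)"
    using displacement_exchange[OF h bij, of t\<^sub>0 "Y t\<^sub>0"]
      true_at_exchange_evolver[OF h c \<open>t\<^sub>0 \<le> t\<close>, of L M\<^sub>0 A] count
    by (simp flip: X_def Y_def)
  also have "\<dots> \<le> displacement L (X t) (Y t) + displacement L (Y t) (Y t\<^sub>0)"
    by (rule displacement_triangle)
  also have "displacement L (Y t) (Y t\<^sub>0) \<le> int (t - t\<^sub>0)"
    unfolding Y_def using A bij_betw_finite[OF M0] \<open>t\<^sub>0 \<le> t\<close>
    by (intro displacement_hyp_at) auto
  also have "displacement L (X t) (Y t) = int (distance (path_graph (4 * h)) L (X t) (Y t))"
    using bij[of t] hypothesis_in_path_graph[OF A]
    by (intro distance_path_graph[symmetric]) (auto simp: bij_betw_def Y_def hyp_at_def)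
  finally show ?thesis
    by (simp add: distance_at_eq X_def Y_def)
qed

theorem theorem10:
  fixes \<delta> :: real
  assumes "\<delta> > 0" and "2 - \<delta> \<ge> 1"
  shows "\<exists>\<gamma>::real. \<gamma> > 0 \<and>
    (\<forall>t\<^sub>0::nat. \<forall>N::nat. \<exists>n\<ge>N.
      \<exists>(T :: nat pair_pre_digraph) (E :: (nat, nat) evolver) (t :: nat).
        undirected_tree T \<and> card (pverts T) = n \<and> is_evolver T E \<and> t > t\<^sub>0 \<and>
        (\<forall>M\<^sub>0 A. bij_betw M\<^sub>0 {1..n} (pverts T) \<longrightarrow> A \<in> class_C T {1..n} \<longrightarrow>
          real (distance_at T {1..n} (2 - \<delta>) E M\<^sub>0 A t) \<ge> \<gamma> * (real n)\<^sup>2))"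
\<comment> \<open>With \<open>n = 4 * h\<close> the bound to reach is
  \<open>\<delta> * h * h / 2\<close>, half of the leading term of what remains; the other half
  absorbs the rounding loss of 1.\<close>
proof (intro exI[of _ "\<delta> / 32"] conjI allI)
  show "0 < \<delta> / 32"
    using assms by simp
next
  fix t\<^sub>0 N :: nat
  define c where "c = 2 - \<delta>"
  \<comment> \<open>The first bound makes \<open>h\<close> positive and \<open>n\<close> at least
    \<open>N\<close>; the second gives \<open>\<delta> * h * h \<ge> 2\<close>.\<close>
  define h where "h = max (Suc N) (nat \<lceil>2 / \<delta>\<rceil>)"
  have c: "1 \<le> c"
    using assms by (simp add: c_def)
  have "Suc N \<le> h"
    by (simp add: h_def)
  then have h: "0 < h" "N \<le> 4 * h"
    by simp_all
  have "2 / \<delta> \<le> real h"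
    unfolding h_def by linarith
  then have "2 \<le> \<delta> * real h"
    using assms by (simp add: field_simps)
  also have "\<dots> \<le> \<delta> * real h * real h"
    using assms h by simp
  finally have large: "2 \<le> \<delta> * real h * real h" .
  \<comment> \<open>This time depends only on \<open>c\<close>, \<open>h\<close> and
    \<open>t\<^sub>0\<close>, so it can be chosen before \<open>M\<^sub>0\<close> and the
    algorithm.\<close>
  obtain t where t: "t\<^sub>0 < t" "swap_count c t = swap_count c t\<^sub>0 + h * h"
    "real t \<le> real t\<^sub>0 + c * real (h * h) + 1"
    using ex_swap_count_eq[OF c, of "h * h"] h by auto
  have "\<delta> / 32 * (real (4 * h))\<^sup>2 \<le>
      real (distance_at (path_graph (4 * h)) {1..4 * h} c (exchange_evolver h {1..4 * h} c t\<^sub>0) M\<^sub>0 A t)"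
    if "bij_betw M\<^sub>0 {1..4 * h} {..<4 * h}" "A \<in> class_C (path_graph (4 * h)) {1..4 * h}" for M\<^sub>0 A
  proof -
    have "\<delta> / 32 * (real (4 * h))\<^sup>2 \<le> \<delta> * real h * real h - 1"
      using large by (simp add: power2_eq_square)
    \<comment> \<open>Each swap is worth 2 and leaves the algorithm about \<open>c\<close> moves, a
      net gain of \<open>2 - c = \<delta>\<close> per swap.\<close>
    also have "\<dots> = 2 * real h * real h - (c * real (h * h) + 1)"
      by (simp add: c_def algebra_simps)
    also have "\<dots> \<le> real_of_int (int (2 * h * h) - int (t - t\<^sub>0))"
      using t by (simp add: of_nat_diff)
    also have "\<dots> \<le> real (distance_at (path_graph (4 * h)) {1..4 * h} c
        (exchange_evolver h {1..4 * h} c t\<^sub>0) M\<^sub>0 A t)"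
      using distance_at_exchange_evolver[OF h(1) c _ t(2) that] t(1)
      by (metis less_imp_le of_int_le_iff of_int_of_nat_eq)
    finally show ?thesis .
  qed
  then show "\<exists>n\<ge>N. \<exists>(T :: nat pair_pre_digraph) (E :: (nat, nat) evolver) t.
      undirected_tree T \<and> card (pverts T) = n \<and> is_evolver T E \<and> t\<^sub>0 < t \<and>
      (\<forall>M\<^sub>0 A. bij_betw M\<^sub>0 {1..n} (pverts T) \<longrightarrow> A \<in> class_C T {1..n} \<longrightarrow>
        \<delta> / 32 * (real n)\<^sup>2 \<le> real (distance_at T {1..n} (2 - \<delta>) E M\<^sub>0 A t))"
    using h t(1) undirected_tree_path_graph[of "4 * h"] is_evolver_exchange_evolver[OF h(1)]
    unfolding c_def
    by (intro exI[of _ "4 * h"] exI[of _ "path_graph (4 * h)"]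
        exI[of _ "exchange_evolver h {1..4 * h} (2 - \<delta>) t\<^sub>0"] exI[of _ t] conjI) auto
qed

end
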